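(* Let $a>0$, $b>0$, $c\in(0,1)$, let $X=(X_t)_{t\ge0}$ be the tempered stable subordinator with parameters $(a,b;c)$, and let $\tilde X=(\tilde X_t)_{t\ge0}$ be its running average, $\tilde X_t=\frac1t\int_0^t X_s\,\mathrm{d}s$ for $t>0$, with $\tilde X_0=0$ almost surely. Then the Laplace transform of $\tilde X_t$ is $$\bar f_{\tilde X_t}(u)\equiv\bar f_{\tilde X_t}(u\,|\,a,b;c):=\mathbb{E}\,e^{-u\tilde X_t}=\exp\left(\frac{at\,\Gamma(-c)\left((b+u)^{c+1}-b^{c}\left(b+(c+1)u\right)\right)}{(c+1)u}\right),\quad u\in\mathbb{C}\setminus(-\infty,-b],\ t\ge0.$$
   Context: For $a>0$, $b>0$, $c\in(0,1)$, the tempered stable subordinator with parameters $(a,b;c)$ is the Lévy process $X=(X_t)_{t\ge0}$ (starting from $0$ almost surely, with independent and stationary increments and almost surely càdlàg sample paths) whose marginal distribution is the one-sided tempered stable distribution with Laplace transform $\mathbb{E}\,e^{-uX_t}=\exp\left(at\,\Gamma(-c)\left((b+u)^c-b^c\right)\right)$ for $u\in\mathbb{C}\setminus(-\infty,-b]$, $t\ge0$. It is a purely discontinuous nondecreasing process with no Brownian component and with Lévy density $\frac{a e^{-bx}}{x^{c+1}}$ on $x>0$ (and zero for $x\le0$). $\Gamma(\cdot)$ is the gamma function, complex powers are taken on the principal branch, and the closed-form expression has a removable singularity at $u=0$.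
   Formalization: For t>0 and Re u < -b the expectations of e^{-uX_t} and e^{-uX̃_t} do not converge; there both formulas are read as analytic continuation: the closed form is holomorphic on C\(-∞,-b] and equals the expectation wherever it converges, in particular for all such u with Re u ≥ -b. *)

theory Defs
  imports "HOL-Probability.Probability" "HOL-Complex_Analysis.Complex_Analysis"
begin

definition cadlag_on_nonneg :: "(real \<Rightarrow> real) \<Rightarrow> bool" where
  "cadlag_on_nonneg f \<longleftrightarrow>
     (\<forall>t\<ge>0. (f \<longlongrightarrow> f t) (at_right t)) \<and>
     (\<forall>t>0. \<exists>l. (f \<longlongrightarrow> l) (at_left t))"

text \<open>Time is \<^typ>\<open>real\<close>, but only the values at nonnegative times are constrained.\<close>

definition levy_process :: "'w measure \<Rightarrow> (real \<Rightarrow> 'w \<Rightarrow> real) \<Rightarrow> bool" where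
  "levy_process M X \<longleftrightarrow>
     prob_space M \<and>
     (\<forall>t\<ge>0. X t \<in> borel_measurable M) \<and>
     (AE \<omega> in M. X 0 \<omega> = 0) \<and>
     (\<forall>(n::nat) (s::nat \<Rightarrow> real). 0 \<le> s 0 \<and> (\<forall>i<n. s i \<le> s (Suc i)) \<longrightarrow>
        prob_space.indep_vars M (\<lambda>_. borel) (\<lambda>i \<omega>. X (s (Suc i)) \<omega> - X (s i) \<omega>) {..<n}) \<and>
     (\<forall>s\<ge>0. \<forall>h\<ge>0. distr M borel (\<lambda>\<omega>. X (s + h) \<omega> - X s \<omega>)
                   = distr M borel (\<lambda>\<omega>. X h \<omega> - X 0 \<omega>)) \<and>
     (AE \<omega> in M. cadlag_on_nonneg (\<lambda>t. X t \<omega>))"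

definition slit_plane :: "real \<Rightarrow> complex set" where
  "slit_plane b = UNIV - complex_of_real ` {..-b}"

text \<open>
  \<open>F\<close> is the Laplace transform \<open>E exp (- u Y)\<close> on the plane slit along \<open>(-\<infinity>, -b]\<close>.
  For the tempered stable law the expectation converges absolutely exactly for \<open>Re u \<ge> -b\<close>
  (except for a degenerate \<open>Y\<close>, where it converges everywhere); for the remaining \<open>u\<close> the
  Bochner integral would have the default value 0, and the transform is the analytic
  continuation, which is unique because the slit plane is connected.
  Hence: \<open>F\<close> is holomorphic on the whole slit plane, the expectation converges at least for
  \<open>Re u \<ge> -b\<close>, and it equals \<open>F u\<close> at every \<open>u\<close> of the slit plane where it converges.
\<close>

definition has_laplace_transform ::
  "'w measure \<Rightarrow> ('w \<Rightarrow> real) \<Rightarrow> real \<Rightarrow> (complex \<Rightarrow> complex) \<Rightarrow> bool" where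
  "has_laplace_transform M Y b F \<longleftrightarrow>
     F holomorphic_on slit_plane b \<and>
     (\<forall>u \<in> slit_plane b. Re u \<ge> -b \<longrightarrow>
        integrable M (\<lambda>\<omega>. exp (- u * complex_of_real (Y \<omega>)))) \<and>
     (\<forall>u \<in> slit_plane b. integrable M (\<lambda>\<omega>. exp (- u * complex_of_real (Y \<omega>))) \<longrightarrow>
        (LINT \<omega>|M. exp (- u * complex_of_real (Y \<omega>))) = F u)"

definition tempered_stable_subordinator ::
  "'w measure \<Rightarrow> (real \<Rightarrow> 'w \<Rightarrow> real) \<Rightarrow> real \<Rightarrow> real \<Rightarrow> real \<Rightarrow> bool" where
  "tempered_stable_subordinator M X a b c \<longleftrightarrow>
     levy_process M X \<and>
     (\<forall>t\<ge>0. has_laplace_transform M (X t) b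
        (\<lambda>u. exp (of_real (a * t * Gamma (-c)) *
               ((of_real b + u) powr of_real c - of_real (b powr c)))))"

text \<open>
  The pathwise integral is only meaningful on the almost sure event of cadlag paths, and
  \<open>M\<close> need not be complete. The running average is therefore any family of random variables
  that agrees with it almost surely.
\<close>

definition running_average ::
  "'w measure \<Rightarrow> (real \<Rightarrow> 'w \<Rightarrow> real) \<Rightarrow> (real \<Rightarrow> 'w \<Rightarrow> real) \<Rightarrow> bool" where
  "running_average M X A \<longleftrightarrow>
     (\<forall>t\<ge>0. A t \<in> borel_measurable M) \<and>
     (\<forall>t>0. AE \<omega> in M. A t \<omega> = (1 / t) * (LINT s:{0..t}|lborel. X s \<omega>)) \<and>
     (AE \<omega> in M. A 0 \<omega> = 0)"

text \<open>
  The closed form of the Laplace transform of the running average has the shape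
  \<open>exp (g u / ((c + 1) * u))\<close> with \<open>g\<close> vanishing to second order at 0. The value 1 at
  \<open>u = 0\<close> given by \<open>x / 0 = 0\<close> is therefore the one that removes the singularity.
\<close>

end

theory Submission
  imports Defs
begin

text \<open>
  The running average is the limit of right Riemann sums of the path, and summation by parts turns
  such a sum into a weighted sum of independent increments,
  \<open>1/N \<Sum>k=1..N. X (k t/N) = X 0 + \<Sum>j<N. (N - j)/N \<cdot> (X ((j+1) t/N) - X (j t/N))\<close>.
  If \<open>E exp (- v X s) = exp (s \<psi> v)\<close>, its Laplace transform is therefore
  \<open>exp (t/N \<Sum>k=1..N. \<psi> (u k/N))\<close>, which tends to
  \<open>exp (t \<integral>x\<in>{0..1}. \<psi> (u x))\<close>. On the imaginary axis dominated convergence identifies the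
  limit with the transform of the average. For real \<open>u > -b\<close>, negativity of \<open>\<Gamma>(-c)\<close> bounds the
  transforms of the Riemann sums by \<open>exp (- a t \<Gamma>(-c) b\<^sup>c)\<close> uniformly in \<open>u\<close> and \<open>N\<close>, so Fatou's
  lemma yields integrability on the closed half plane \<open>Re u \<ge> -b\<close>. The identity theorem extends
  the equality from the imaginary axis to wherever the expectation converges.
\<close>

section \<open>Riemann sums of cadlag paths\<close>

text \<open>Through the ceiling function, disjointness of the cells and the choice of the cell
  around a given point become integer arithmetic.\<close>

lemma mem_partition_cell_iff:
  fixes s t :: real
  assumes "t > 0" "n > 0"
  shows "s \<in> {(real k - 1) * t / real n<..real k * t / real n} \<longleftrightarrow> int k = \<lceil>real n * s / t\<rceil>"
proof -
  have "int k = \<lceil>real n * s / t\<rceil> \<longleftrightarrow> real k - 1 < real n * s / t \<and> real n * s / t \<le> real k"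
    by (smt (verit) ceiling_unique ceiling_correct of_int_of_nat_eq)
  also have "\<dots> \<longleftrightarrow> s \<in> {(real k - 1) * t / real n<..real k * t / real n}"
    using assms by (auto simp: field_simps)
  finally show ?thesis ..
qed

text \<open>Each sum is the integral of the step function that takes on every cell the value of
  \<open>f\<close> at the right endpoint. The sample points approach \<open>s\<close> from the
  right, so right continuity gives pointwise convergence and \<open>bdd\<close> gives a constant
  dominating function.\<close>

lemma right_riemann_sums_tendsto:
  fixes f :: "real \<Rightarrow> 'a::{banach, second_countable_topology}"
  assumes t: "t > 0"
    and right: "\<And>s. 0 \<le> s \<Longrightarrow> s < t \<Longrightarrow> (f \<longlongrightarrow> f s) (at_right s)"
    and bdd: "bounded (f ` {0..t})"
  shows "(\<lambda>n. (t / real (Suc n)) *\<^sub>R (\<Sum>k=1..Suc n. f (real k * t / real (Suc n))))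
           \<longlonglongrightarrow> (LINT s:{0..t}|lborel. f s)"
proof -
  define I where "I n k = {(real k - 1) * t / real (Suc n)<..real k * t / real (Suc n)}" for n k :: nat
  define g where "g n s = (\<Sum>k=1..Suc n. indicator (I n k) s *\<^sub>R f (real k * t / real (Suc n)))" for n s
  obtain B where B: "norm (f s) \<le> B" if "s \<in> {0..t}" for s
    using bdd unfolding bounded_iff by blast
  have B0: "0 \<le> B"
    using norm_ge_zero B[of 0] t by (metis atLeastAtMost_iff less_eq_real_def order_trans)
  have I_iff: "s \<in> I n k \<longleftrightarrow> int k = \<lceil>real (Suc n) * s / t\<rceil>" for n k s
    unfolding I_def by (rule mem_partition_cell_iff[OF t]) simp
  \<comment> \<open>\<open>\<kappa> n s\<close> is the right endpoint of the cell that contains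
    \<open>s\<close>.\<close>
  define \<kappa> where "\<kappa> n s = real_of_int \<lceil>real (Suc n) * s / t\<rceil> * t / real (Suc n)" for n s
  have cell: "g n s = f (\<kappa> n s) \<and> s \<le> \<kappa> n s \<and> \<kappa> n s \<le> s + t / real (Suc n) \<and> \<kappa> n s \<le> t"
    if s: "s \<in> {0<..t}" for n s
  proof -
    define k where "k = nat \<lceil>real (Suc n) * s / t\<rceil>"
    have pos: "real (Suc n) * s / t > 0" using s t by simp
    hence "\<lceil>real (Suc n) * s / t\<rceil> \<ge> 1" by linarith
    hence k: "int k = \<lceil>real (Suc n) * s / t\<rceil>" and k1: "1 \<le> k" unfolding k_def by linarith+
    have "real (Suc n) * s / t \<le> real (Suc n)"
      using s t mult_left_mono[of s t "real (Suc n)"] by (simp add: pos_divide_le_eq)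
    hence "\<lceil>real (Suc n) * s / t\<rceil> \<le> int (Suc n)" by (simp add: ceiling_le_iff)
    hence kn: "k \<le> Suc n" using k by linarith
    have kap: "\<kappa> n s = real k * t / real (Suc n)"
      unfolding \<kappa>_def k[symmetric] by simp
    have Ik: "s \<in> I n j \<longleftrightarrow> j = k" for j
      by (simp only: I_iff k[symmetric] of_nat_eq_iff)
    have "g n s = (\<Sum>j=1..Suc n. if j = k then f (real j * t / real (Suc n)) else 0)"
      unfolding g_def by (rule sum.cong) (auto simp: indicator_def Ik)
    also have "\<dots> = f (\<kappa> n s)" using k1 kn by (subst sum.delta) (auto simp: kap)
    finally have 1: "g n s = f (\<kappa> n s)" .
    have "s \<in> I n k" by (simp add: Ik)
    hence 2: "s \<le> \<kappa> n s" "(real k - 1) * t / real (Suc n) < s"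
      unfolding kap I_def by auto
    hence "\<kappa> n s \<le> s + t / real (Suc n)"
      unfolding kap by (simp add: left_diff_distrib diff_divide_distrib)
    moreover have "real k * t \<le> t * real (Suc n)"
      using kn t by (metis mult.commute mult_right_mono less_imp_le of_nat_le_iff)
    hence "\<kappa> n s \<le> t" unfolding kap by (simp add: pos_divide_le_eq)
    ultimately show ?thesis using 1 2 by blast
  qed
  have out: "g n s = 0" if s: "s \<notin> {0<..t}" for n s
  proof -
    have "s \<notin> I n k" if "k \<in> {1..Suc n}" for k
    proof -
      have "I n k \<subseteq> {0<..t}"
      proof -
        have "0 \<le> (real k - 1) * t / real (Suc n)" using that t by simp
        moreover have "real k * t \<le> t * real (Suc n)"
          using that t by (metis atLeastAtMost_iff mult.commute mult_right_mono less_imp_le of_nat_le_iff)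
        hence "real k * t / real (Suc n) \<le> t" by (simp add: pos_divide_le_eq)
        ultimately show ?thesis unfolding I_def by auto
      qed
      thus ?thesis using s by auto
    qed
    thus ?thesis unfolding g_def by (intro sum.neutral) auto
  qed
  have meas: "g n \<in> borel_measurable lborel" for n
    unfolding g_def I_def by measurable
  have lim: "(\<lambda>n. g n s) \<longlonglongrightarrow> indicator {0<..t} s *\<^sub>R f s" for s
  proof (cases "s \<in> {0<..t}")
    case False thus ?thesis using out by simp
  next
    case True
    have kl: "(\<lambda>n. \<kappa> n s) \<longlonglongrightarrow> s"
    proof (rule tendsto_sandwich[of "\<lambda>_. s"])
      show "\<forall>\<^sub>F n in sequentially. s \<le> \<kappa> n s" using cell[OF True] by simp
      show "\<forall>\<^sub>F n in sequentially. \<kappa> n s \<le> s + t / real (Suc n)" using cell[OF True] by simp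
      have "(\<lambda>n. s + t * inverse (real (Suc n))) \<longlonglongrightarrow> s + t * 0"
        by (intro tendsto_intros LIMSEQ_inverse_real_of_nat)
      thus "(\<lambda>n. s + t / real (Suc n)) \<longlonglongrightarrow> s" by (simp add: divide_inverse)
    qed simp
    have "(\<lambda>n. f (\<kappa> n s)) \<longlonglongrightarrow> f s"
    \<comment> \<open>\<open>right\<close> covers only \<open>s < t\<close>. At the endpoint,
      \<open>s \<le> \<kappa> n s\<close> and \<open>\<kappa> n s \<le> t\<close> pin the sample
      point to \<open>t\<close>.\<close>
    proof (cases "s = t")
      case True
      with cell \<open>s \<in> {0<..t}\<close> have "\<kappa> n s = s" for n by (metis order_antisym)
      thus ?thesis by simp
    next
      case False
      with True have "(f \<longlongrightarrow> f s) (at_right s)" by (intro right) auto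
      hence "continuous (at s within {s..}) f"
        by (simp add: continuous_within at_within_Ici_at_right)
      thus ?thesis using kl cell[OF True]
        unfolding continuous_within_sequentially by (auto simp: o_def)
    qed
    thus ?thesis using True cell by simp
  qed
  \<comment> \<open>Measurability of the integrand is inherited from the step functions converging
    to it.\<close>
  have meas_lim: "(\<lambda>s. indicator {0<..t} s *\<^sub>R f s) \<in> borel_measurable lborel"
    by (rule borel_measurable_LIMSEQ_metric[OF meas lim])
  have "(\<lambda>n. integral\<^sup>L lborel (g n)) \<longlonglongrightarrow> (LINT s|lborel. indicator {0<..t} s *\<^sub>R f s)"
  proof (rule integral_dominated_convergence[where w="\<lambda>s. B * indicator {0<..t} s"])
    show "integrable lborel (\<lambda>s. B * indicator {0<..t} s :: real)"
      using t by (intro integrable_mult_right integrable_real_indicator) auto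
    show "AE s in lborel. norm (g n s) \<le> B * indicator {0<..t} s" for n
    proof (intro AE_I2)
      fix s show "norm (g n s) \<le> B * indicator {0<..t} s"
      proof (cases "s \<in> {0<..t}")
        case True
        with cell[OF True, of n] have "\<kappa> n s \<in> {0..t}" by auto
        thus ?thesis using True cell[OF True, of n] B by simp
      qed (simp add: out)
    qed
  qed (use meas meas_lim lim in auto)
  also have "(\<lambda>n. integral\<^sup>L lborel (g n))
      = (\<lambda>n. (t / real (Suc n)) *\<^sub>R (\<Sum>k=1..Suc n. f (real k * t / real (Suc n))))"
  proof
    fix n
    have int_I: "integrable lborel (indicator (I n k) :: real \<Rightarrow> real)" for k
      unfolding I_def using t
      by (intro integrable_real_indicator, simp, subst emeasure_lborel_Ioc)
         (auto simp: left_diff_distrib diff_divide_distrib)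
    have "measure lborel (I n k) = t / real (Suc n)" for k
      unfolding I_def using t by (subst measure_lborel_Ioc) (auto simp: left_diff_distrib diff_divide_distrib)
    hence cell_integral: "(LINT s|lborel. indicator (I n k) s *\<^sub>R c) = (t / real (Suc n)) *\<^sub>R c" for k and c :: 'a
      by (subst integral_scaleR_left[OF int_I]) simp
    have "integral\<^sup>L lborel (g n)
        = (\<Sum>k=1..Suc n. LINT s|lborel. indicator (I n k) s *\<^sub>R f (real k * t / real (Suc n)))"
      unfolding g_def by (intro Bochner_Integration.integral_sum integrable_scaleR_left int_I)
    thus "integral\<^sup>L lborel (g n) = (t / real (Suc n)) *\<^sub>R (\<Sum>k=1..Suc n. f (real k * t / real (Suc n)))"
      by (simp only: cell_integral scaleR_sum_right)
  qed
  \<comment> \<open>The half-open and the closed interval differ in the null set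
    \<open>{0}\<close>.\<close>
  also have "(LINT s|lborel. indicator {0<..t} s *\<^sub>R f s) = (LINT s:{0..t}|lborel. f s)"
    unfolding set_lebesgue_integral_def
    by (rule integral_discrete_difference[of "{0}"]) (auto simp: indicator_def)
  finally show ?thesis .
qed

text \<open>One-sided limits give boundedness near every point, and Bolzano's bisection principle
  glues the local bounds together.\<close>

lemma cadlag_on_nonneg_bounded:
  assumes "cadlag_on_nonneg f" "0 \<le> t"
  shows "bounded (f ` {0..t})"
proof -
  \<comment> \<open>Bisection tests intervals around \<open>x\<close> that may reach to the left of
    0, where the path is unconstrained; intersecting with \<open>{0..}\<close> cuts that piece
    off.\<close>
  have "bounded (f ` ({0..t} \<inter> {0..}))"
    using assms(2)
  proof (induction rule: Bolzano[where P="\<lambda>x y. bounded (f ` ({x..y} \<inter> {0..}))"])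
    case (trans x y z)
    hence "f ` ({x..z} \<inter> {0..}) \<subseteq> f ` ({x..y} \<inter> {0..}) \<union> f ` ({y..z} \<inter> {0..})"
      by (simp only: image_Un[symmetric], intro image_mono) auto
    thus ?case using trans by (meson bounded_Un bounded_subset)
  next
    case (local x)
    have near: "\<exists>B. \<exists>d>0. \<forall>y. y \<in> A \<longrightarrow> y \<noteq> x \<longrightarrow> \<bar>y - x\<bar> < d \<longrightarrow> norm (f y) \<le> B"
      if "(f \<longlongrightarrow> l) (at x within A)" for l A
    proof -
      have "\<forall>\<^sub>F y in at x within A. dist (f y) l < 1"
        using that by (rule tendstoD) simp
      then obtain d where "d > 0" "\<forall>y\<in>A. y \<noteq> x \<and> dist y x < d \<longrightarrow> dist (f y) l < 1"
        by (auto simp: eventually_at)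
      hence "\<forall>y. y \<in> A \<longrightarrow> y \<noteq> x \<longrightarrow> \<bar>y - x\<bar> < d \<longrightarrow> norm (f y) \<le> norm l + 1"
        by (smt (verit) dist_real_def real_norm_def)
      thus ?thesis using \<open>d > 0\<close> by blast
    qed
    have "(f \<longlongrightarrow> f x) (at_right x)"
      using assms(1) local by (simp add: cadlag_on_nonneg_def)
    then obtain d1 B1 where 1: "d1 > 0" "\<forall>y>x. \<bar>y - x\<bar> < d1 \<longrightarrow> norm (f y) \<le> B1"
      using near by (metis greaterThan_iff less_irrefl)
    obtain d2 B2 where 2: "d2 > 0" "\<forall>y. 0 \<le> y \<longrightarrow> y < x \<longrightarrow> \<bar>y - x\<bar> < d2 \<longrightarrow> norm (f y) \<le> B2"
    proof (cases "x = 0")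
      case True thus ?thesis by (intro that[of 1]) auto
    next
      case False
      then obtain l where "(f \<longlongrightarrow> l) (at_left x)"
        using assms(1) local unfolding cadlag_on_nonneg_def by (metis less_eq_real_def)
      then obtain d2 B2 where "d2 > 0" "\<forall>y<x. \<bar>y - x\<bar> < d2 \<longrightarrow> norm (f y) \<le> B2"
        using near by (metis lessThan_iff less_irrefl)
      thus ?thesis using that by blast
    qed
    have "bounded (f ` ({p..q} \<inter> {0..}))" if "p \<le> x" "x \<le> q" "q - p < min d1 d2" for p q
      unfolding bounded_iff
    \<comment> \<open>The one-sided limits control punctured neighbourhoods;
      \<open>norm (f x)\<close> accounts for \<open>x\<close> itself.\<close>
    proof (intro exI[of _ "max (norm (f x)) (max B1 B2)"] ballI)
      fix z assume "z \<in> f ` ({p..q} \<inter> {0..})"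
      then obtain y where y: "z = f y" "p \<le> y" "y \<le> q" "0 \<le> y" by auto
      have "\<bar>y - x\<bar> < d1" "\<bar>y - x\<bar> < d2" using that y by auto
      with 1 2 y show "norm z \<le> max (norm (f x)) (max B1 B2)"
        by (cases "y = x"; cases "y < x") (auto simp: le_max_iff_disj)
    qed
    thus ?case using 1 2 by (intro exI[of _ "min d1 d2"]) auto
  qed
  moreover have "{0..t} \<inter> {0..} = {0..t}" by auto
  ultimately show ?thesis by simp
qed

section \<open>Two-sided Laplace transforms on the slit plane\<close>

lemma mem_slit_plane_iff: "u \<in> slit_plane b \<longleftrightarrow> Im u \<noteq> 0 \<or> Re u > - b"
  by (auto simp: slit_plane_def image_iff complex_eq_iff not_le)

lemma slit_plane_iff_nonpos_Reals: "u \<in> slit_plane b \<longleftrightarrow> of_real b + u \<notin> \<real>\<^sub>\<le>\<^sub>0"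
  by (auto simp: mem_slit_plane_iff complex_nonpos_Reals_iff)

lemma open_slit_plane: "open (slit_plane b)"
proof -
  have "slit_plane b = (\<lambda>u. of_real b + u) -` (- \<real>\<^sub>\<le>\<^sub>0)"
    by (auto simp: slit_plane_iff_nonpos_Reals)
  thus ?thesis by (auto intro!: open_vimage continuous_intros)
qed

text \<open>The modulus of the integrand depends on \<open>Re u\<close> alone, so questions of
  integrability reduce to real exponents.\<close>

lemma integrable_exp_complex_iff:
  assumes [measurable]: "Y \<in> borel_measurable M"
  shows "integrable M (\<lambda>\<omega>. exp (- u * complex_of_real (Y \<omega>)))
           \<longleftrightarrow> integrable M (\<lambda>\<omega>. exp (- Re u * Y \<omega>))"
  by (subst integrable_norm_iff[symmetric]) auto

text \<open>The sign of \<open>y\<close> decides which endpoint dominates; adding both gives one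
  bound for random variables of either sign.\<close>

lemma exp_le_add_exp:
  fixes r r1 r2 y :: real
  assumes "r1 \<le> r" "r \<le> r2"
  shows "exp (- r * y) \<le> exp (- r1 * y) + exp (- r2 * y)"
proof (cases "y \<ge> 0")
  case True
  hence "exp (- r * y) \<le> exp (- r1 * y)" using assms by (simp add: mult_right_mono)
  thus ?thesis by (simp add: add_increasing2)
next
  case False
  hence "exp (- r * y) \<le> exp (- r2 * y)" using assms by (simp add: mult_right_mono_neg)
  thus ?thesis by (simp add: add_increasing)
qed

lemma integrable_exp_between:
  fixes Y :: "'w \<Rightarrow> real"
  assumes [measurable]: "Y \<in> borel_measurable M"
    and "integrable M (\<lambda>\<omega>. exp (- r1 * Y \<omega>))" "integrable M (\<lambda>\<omega>. exp (- r2 * Y \<omega>))"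
    and "r1 \<le> r" "r \<le> r2"
  shows "integrable M (\<lambda>\<omega>. exp (- r * Y \<omega>))"
  by (rule Bochner_Integration.integrable_bound[OF Bochner_Integration.integrable_add[OF assms(2,3)]])
     (use exp_le_add_exp[OF assms(4,5)] in \<open>auto simp: abs_of_pos add_pos_pos\<close>)

text \<open>A dominating function for differentiation under the integral, uniform in
  \<open>h\<close>. One factor \<open>exp (\<delta> * \<bar>y\<bar>)\<close> comes from the
  increment \<open>h\<close>, a second one absorbs the linear factor \<open>\<bar>y\<bar>\<close>;
  hence the shift by \<open>2 * \<delta>\<close>, to both sides because \<open>y\<close> may have
  either sign.\<close>

lemma norm_exp_difference_quotient_le:
  fixes h v :: complex and y \<delta> :: real
  assumes \<delta>: "\<delta> > 0" and h: "h \<noteq> 0" "norm h \<le> \<delta>"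
  shows "norm ((exp (- (v + h) * of_real y) - exp (- v * of_real y)) / h)
           \<le> (exp (- (Re v - 2 * \<delta>) * y) + exp (- (Re v + 2 * \<delta>) * y)) / \<delta>"
proof -
  have "norm (exp (- h * of_real y) - 1) \<le> exp (norm (- h * of_real y)) * norm (- h * of_real y)"
    using Taylor_exp_field[of "- h * of_real y" 0] by simp
  also have "\<dots> = exp (norm h * \<bar>y\<bar>) * (norm h * \<bar>y\<bar>)" by (simp add: norm_mult)
  also have "\<dots> \<le> exp (\<delta> * \<bar>y\<bar>) * (norm h * \<bar>y\<bar>)"
    using h by (intro mult_right_mono) (auto simp: mult_right_mono)
  finally have 1: "norm (exp (- h * of_real y) - 1) \<le> norm h * (exp (\<delta> * \<bar>y\<bar>) * \<bar>y\<bar>)"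
    by (simp add: mult_ac)
  have "\<delta> * \<bar>y\<bar> \<le> exp (\<delta> * \<bar>y\<bar>)" using exp_ge_add_one_self[of "\<delta> * \<bar>y\<bar>"] by linarith
  hence 2: "\<bar>y\<bar> \<le> exp (\<delta> * \<bar>y\<bar>) / \<delta>" using \<delta> by (simp add: field_simps)
  have "norm ((exp (- (v + h) * of_real y) - exp (- v * of_real y)) / h)
      = norm (exp (- v * of_real y)) * (norm (exp (- h * of_real y) - 1) / norm h)"
    by (simp add: norm_mult[symmetric] norm_divide[symmetric] ring_distribs exp_add[symmetric]
        del: norm_mult norm_divide norm_exp_eq_Re)
  also have "\<dots> \<le> exp (- Re v * y) * (exp (\<delta> * \<bar>y\<bar>) * \<bar>y\<bar>)"
    using 1 h by (intro mult_mono) (auto simp: field_simps)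
  also have "\<dots> \<le> exp (- Re v * y) * (exp (\<delta> * \<bar>y\<bar>) * (exp (\<delta> * \<bar>y\<bar>) / \<delta>))"
    using 2 by (intro mult_left_mono) auto
  also have "\<dots> = exp (- Re v * y + 2 * \<delta> * \<bar>y\<bar>) / \<delta>"
    by (simp add: exp_add[symmetric])
  also have "\<dots> \<le> (exp (- (Re v - 2 * \<delta>) * y) + exp (- (Re v + 2 * \<delta>) * y)) / \<delta>"
  proof (rule divide_right_mono)
    have "- Re v * y + 2 * \<delta> * \<bar>y\<bar> = - (Re v - 2 * \<delta>) * y
        \<or> - Re v * y + 2 * \<delta> * \<bar>y\<bar> = - (Re v + 2 * \<delta>) * y"
      by (simp add: abs_if algebra_simps)
    thus "exp (- Re v * y + 2 * \<delta> * \<bar>y\<bar>) \<le> exp (- (Re v - 2 * \<delta>) * y) + exp (- (Re v + 2 * \<delta>) * y)"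
      by (elim disjE) (simp_all only: le_add_same_cancel1 le_add_same_cancel2 exp_ge_zero)
  qed (use \<delta> in simp)
  finally show ?thesis .
qed

text \<open>Dominated convergence along sequences of increments tending to 0 moves the complex
  derivative under the integral.\<close>

lemma laplace_holomorphic:
  fixes Y :: "'w \<Rightarrow> real"
  assumes Y[measurable]: "Y \<in> borel_measurable M"
    and int: "\<And>r. r > r0 \<Longrightarrow> integrable M (\<lambda>\<omega>. exp (- r * Y \<omega>))"
  shows "(\<lambda>u. LINT \<omega>|M. exp (- u * complex_of_real (Y \<omega>))) holomorphic_on {u. Re u > r0}"
proof (subst holomorphic_on_open)
  show "open {u. Re u > r0}" by (simp add: open_halfspace_Re_gt)
  show "\<forall>v\<in>{u. Re u > r0}. \<exists>D. ((\<lambda>u. LINT \<omega>|M. exp (- u * complex_of_real (Y \<omega>))) has_field_derivative D) (at v)"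
  proof
    fix v assume "v \<in> {u. Re u > r0}"
    hence v: "Re v > r0" by simp
    \<comment> \<open>A quarter of the distance to the boundary line keeps both shifts of
      \<open>Re v\<close> by \<open>2 * \<delta>\<close> inside the region of integrability.\<close>
    define \<delta> where "\<delta> = (Re v - r0) / 4"
    have \<delta>: "\<delta> > 0" "Re v - 2 * \<delta> > r0" "Re v + 2 * \<delta> > r0" using v by (auto simp: \<delta>_def field_simps)
    define q where "q h \<omega> = (exp (- (v + h) * complex_of_real (Y \<omega>)) - exp (- v * complex_of_real (Y \<omega>))) / h" for h \<omega>
    have [measurable]: "q h \<in> borel_measurable M" for h unfolding q_def by measurable
    define D where "D = (LINT \<omega>|M. exp (- v * complex_of_real (Y \<omega>)) * - complex_of_real (Y \<omega>))"
    have cint: "integrable M (\<lambda>\<omega>. exp (- u * complex_of_real (Y \<omega>)))" if "Re u > r0" for u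
      using int[OF that] by (simp only: integrable_exp_complex_iff[OF Y])
    have lim: "((\<lambda>h. q h \<omega>) \<longlongrightarrow> exp (- v * complex_of_real (Y \<omega>)) * - complex_of_real (Y \<omega>)) (at 0)" for \<omega>
    proof -
      have "((\<lambda>u. exp (- u * complex_of_real (Y \<omega>))) has_field_derivative
          exp (- v * complex_of_real (Y \<omega>)) * - complex_of_real (Y \<omega>)) (at v)"
        by (auto intro!: derivative_eq_intros)
      thus ?thesis unfolding DERIV_def q_def .
    qed
    have seq: "(\<lambda>i. integral\<^sup>L M (q (X i))) \<longlonglongrightarrow> D"
      if X: "\<And>i. X i \<noteq> 0" "X \<longlonglongrightarrow> 0" "\<And>i. norm (X i) \<le> \<delta>" for X :: "nat \<Rightarrow> complex"
      unfolding D_def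
    proof (rule integral_dominated_convergence)
      show "integrable M (\<lambda>\<omega>. (exp (- (Re v - 2 * \<delta>) * Y \<omega>) + exp (- (Re v + 2 * \<delta>) * Y \<omega>)) / \<delta>)"
        using int[OF \<delta>(2)] int[OF \<delta>(3)] by simp
      show "AE \<omega> in M. norm (q (X i) \<omega>) \<le> (exp (- (Re v - 2 * \<delta>) * Y \<omega>) + exp (- (Re v + 2 * \<delta>) * Y \<omega>)) / \<delta>" for i
        unfolding q_def by (intro AE_I2 norm_exp_difference_quotient_le \<delta> X)
      have "filterlim X (at 0) sequentially"
        using X by (simp add: filterlim_at)
      thus "AE \<omega> in M. (\<lambda>i. q (X i) \<omega>) \<longlonglongrightarrow> exp (- v * complex_of_real (Y \<omega>)) * - complex_of_real (Y \<omega>)"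
        using lim by (intro AE_I2) (rule filterlim_compose)
    qed measurable
    \<comment> \<open>Restricting to the ball makes every test sequence satisfy the bound
      \<open>\<delta>\<close> on which the domination rests.\<close>
    have "((\<lambda>h. integral\<^sup>L M (q h)) \<longlongrightarrow> D) (at 0 within ball 0 \<delta>)"
      unfolding tendsto_at_iff_sequentially o_def
      by (intro allI impI seq) (auto simp: less_imp_le)
    hence L: "((\<lambda>h. integral\<^sup>L M (q h)) \<longlongrightarrow> D) (at 0)"
      using at_within_open[of "0::complex" "ball 0 \<delta>"] \<delta>(1) by simp
    \<comment> \<open>For \<open>h\<close> in the ball, \<open>v + h\<close> stays in the half plane
      of convergence, so the difference of integrals is the integral of the difference.\<close>
    have near: "\<forall>\<^sub>F h in at 0. h \<in> ball (0::complex) \<delta>"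
      using \<delta>(1) by (intro eventually_at_in_open') auto
    have "((\<lambda>h. ((LINT \<omega>|M. exp (- (v + h) * complex_of_real (Y \<omega>))) - (LINT \<omega>|M. exp (- v * complex_of_real (Y \<omega>)))) / h) \<longlongrightarrow> D) (at 0)"
    proof (rule Lim_transform_eventually[OF L], use near in eventually_elim)
      case (elim h)
      have "\<bar>Re h\<bar> < \<delta>" using elim abs_Re_le_cmod[of h] by simp
      hence "Re (v + h) > r0" using \<delta> by auto
      from Bochner_Integration.integral_diff[OF cint[OF this] cint[OF v]]
      show ?case by (simp only: q_def[abs_def] integral_divide_zero)
    qed
    thus "\<exists>D. ((\<lambda>u. LINT \<omega>|M. exp (- u * complex_of_real (Y \<omega>))) has_field_derivative D) (at v)"
      unfolding DERIV_def by blast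
  qed
qed

text \<open>The set is star-shaped about 0: contracting towards 0 keeps real parts above the
  negative thresholds \<open>r0\<close> and \<open>- b\<close>, and keeps a nonzero imaginary part
  nonzero until 0 is reached. The identity theorem is applied on this domain.\<close>

lemma connected_halfplane_Int_slit_plane:
  assumes "r0 < 0" "b > 0"
  shows "connected ({u. Re u > r0} \<inter> slit_plane b)"
proof (rule starlike_imp_connected)
  show "starlike ({u. Re u > r0} \<inter> slit_plane b)"
    unfolding starlike_def
  proof (intro bexI[of _ 0] ballI subsetI)
    fix u w assume u: "u \<in> {u. Re u > r0} \<inter> slit_plane b" and "w \<in> closed_segment 0 u"
    then obtain s where s: "0 \<le> s" "s \<le> 1" "w = s *\<^sub>R u" by (auto simp: in_segment)
    have scale: "s * x > m" if "x > m" "m < 0" for x m :: real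
    proof (cases "x \<ge> 0")
      case True thus ?thesis using s that by (meson less_le_trans mult_nonneg_nonneg)
    next
      case False
      hence "x \<le> s * x" using s mult_right_mono_neg[of s 1 x] by auto
      thus ?thesis using that by linarith
    qed
    have "Re u > r0" "Im u \<noteq> 0 \<or> Re u > - b" using u by (auto simp: mem_slit_plane_iff)
    thus "w \<in> {u. Re u > r0} \<inter> slit_plane b"
      using s scale[of r0 "Re u"] scale[of "- b" "Re u"] assms
      by (cases "s = 0") (auto simp: mem_slit_plane_iff)
  qed (use assms in \<open>auto simp: mem_slit_plane_iff\<close>)
qed

text \<open>Values on the imaginary axis determine the transform by the identity theorem on an open
  half plane of convergence cut by the slit; points on the boundary of that half plane follow by
  continuity.\<close>

lemma has_laplace_transformI:
  fixes Y :: "'w \<Rightarrow> real"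
  assumes Y[measurable]: "Y \<in> borel_measurable M" and b: "b > 0"
    and F: "F holomorphic_on slit_plane b"
    and int: "\<And>r. r \<ge> - b \<Longrightarrow> integrable M (\<lambda>\<omega>. exp (- r * Y \<omega>))"
    and im: "\<And>y. (LINT \<omega>|M. exp (- (\<i> * of_real y) * complex_of_real (Y \<omega>))) = F (\<i> * of_real y)"
  shows "has_laplace_transform M Y b F"
  unfolding has_laplace_transform_def
proof (intro conjI ballI impI F)
  fix u assume "- b \<le> Re u"
  thus "integrable M (\<lambda>\<omega>. exp (- u * complex_of_real (Y \<omega>)))"
    unfolding integrable_exp_complex_iff[OF Y] by (rule int)
next
  fix u assume u: "u \<in> slit_plane b" and "integrable M (\<lambda>\<omega>. exp (- u * complex_of_real (Y \<omega>)))"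
  hence intu: "integrable M (\<lambda>\<omega>. exp (- Re u * Y \<omega>))"
    by (simp only: integrable_exp_complex_iff[OF Y])
  \<comment> \<open>The expectation may converge at some \<open>u\<close> to the left of
    \<open>- b\<close>; interpolation between \<open>Re u\<close> and \<open>- b\<close> then gives
    integrability on all of \<open>{r0..}\<close>. Since \<open>r0 < 0\<close>, the imaginary axis
    is interior to the half plane.\<close>
  define r0 where "r0 = min (Re u) (- b)"
  define L where "L v = (LINT \<omega>|M. exp (- v * complex_of_real (Y \<omega>)))" for v
  define S where "S = {v. Re v > r0} \<inter> slit_plane b"
  have int0: "integrable M (\<lambda>\<omega>. exp (- r * Y \<omega>))" if "r \<ge> r0" for r
  proof (cases "r \<ge> - b")
    case False
    with that show ?thesis
      by (intro integrable_exp_between[OF Y intu int[of "- b"]]) (auto simp: r0_def)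
  qed (rule int)
  have r0: "r0 < 0" using b by (simp add: r0_def)
  have eqS: "L v = F v" if v: "v \<in> S" for v
  proof -
    have "L v - F v = 0"
    proof (rule analytic_continuation[where f="\<lambda>v. L v - F v" and S=S and U="range (\<lambda>y. \<i> * of_real y)" and \<xi>=0])
      have "L holomorphic_on {u. Re u > r0}"
        unfolding L_def by (rule laplace_holomorphic[OF Y int0]) simp
      thus "(\<lambda>v. L v - F v) holomorphic_on S"
        unfolding S_def by (intro holomorphic_on_diff) (use F in \<open>auto elim: holomorphic_on_subset\<close>)
      show "open S" unfolding S_def by (intro open_Int open_slit_plane open_halfspace_Re_gt)
      show "connected S" unfolding S_def by (rule connected_halfplane_Int_slit_plane[OF r0 b])
      show "range (\<lambda>y. \<i> * complex_of_real y) \<subseteq> S" "0 \<in> S"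
        using r0 b by (auto simp: S_def mem_slit_plane_iff)
      show "0 islimpt range (\<lambda>y. \<i> * complex_of_real y)"
        unfolding islimpt_approachable
      proof (intro allI impI)
        fix e :: real assume "e > 0"
        thus "\<exists>x'\<in>range (\<lambda>y. \<i> * complex_of_real y). x' \<noteq> 0 \<and> dist x' 0 < e"
          by (intro bexI[OF _ rangeI[of _ "e/2"]]) (auto simp: norm_mult)
      qed
    qed (use v im in \<open>auto simp: L_def\<close>)
    thus ?thesis by simp
  qed
  have "L u = F u"
  proof (cases "Re u > r0")
    case True thus ?thesis using eqS u by (simp add: S_def)
  next
    case False
    \<comment> \<open>\<open>u\<close> lies on the boundary of the half plane of convergence: approach it from the right.\<close>
    hence re: "Re u = r0" by (auto simp: r0_def)
    define w where "w n = u + of_real (inverse (real (Suc n)))" for n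
    have wRe: "Re u < Re (w n)" "Re (w n) \<le> Re u + 1" "Im (w n) = Im u" for n
      by (auto simp: w_def inverse_le_1_iff simp del: of_nat_Suc of_real_inverse)
    have wS: "w n \<in> S" for n
      using u re wRe[of n] by (auto simp: S_def mem_slit_plane_iff)
    have "w \<longlonglongrightarrow> u + of_real 0"
      unfolding w_def by (intro tendsto_intros LIMSEQ_inverse_real_of_nat)
    hence wlim: "w \<longlonglongrightarrow> u" by simp
    have "isCont F u"
      using F u open_slit_plane holomorphic_on_imp_continuous_on continuous_on_eq_continuous_at by blast
    hence "(\<lambda>n. F (w n)) \<longlonglongrightarrow> F u" using wlim by (rule isCont_tendsto_compose)
    moreover have "(\<lambda>n. L (w n)) \<longlonglongrightarrow> L u"
      unfolding L_def
    proof (rule integral_dominated_convergence)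
      \<comment> \<open>The points \<open>w n\<close> stay in the strip between \<open>r0\<close>
        and \<open>r0 + 1\<close>, whose two edges supply the dominating function.\<close>
      show "integrable M (\<lambda>\<omega>. exp (- r0 * Y \<omega>) + exp (- (r0 + 1) * Y \<omega>))"
        by (intro Bochner_Integration.integrable_add int0) auto
      show "AE \<omega> in M. norm (exp (- w n * complex_of_real (Y \<omega>)))
              \<le> exp (- r0 * Y \<omega>) + exp (- (r0 + 1) * Y \<omega>)" for n
      proof (intro AE_I2)
        fix \<omega>
        have "exp (- Re (w n) * Y \<omega>) \<le> exp (- r0 * Y \<omega>) + exp (- (r0 + 1) * Y \<omega>)"
          by (rule exp_le_add_exp) (use wRe[of n] re in auto)
        thus "norm (exp (- w n * complex_of_real (Y \<omega>))) \<le> exp (- r0 * Y \<omega>) + exp (- (r0 + 1) * Y \<omega>)"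
          by simp
      qed
      show "AE \<omega> in M. (\<lambda>n. exp (- w n * complex_of_real (Y \<omega>))) \<longlonglongrightarrow> exp (- u * complex_of_real (Y \<omega>))"
        by (intro AE_I2 tendsto_intros wlim)
    qed measurable
    ultimately show ?thesis using eqS[OF wS] LIMSEQ_unique by auto
  qed
  thus "(LINT \<omega>|M. exp (- u * complex_of_real (Y \<omega>))) = F u" by (simp add: L_def)
qed

section \<open>The averaged exponent\<close>

lemma slit_plane_powr_has_field_derivative:
  assumes "u \<in> slit_plane b"
  shows "((\<lambda>u. (of_real b + u) powr of_real (c + 1)) has_field_derivative
           of_real (c + 1) * (of_real b + u) powr of_real c) (at u)"
  using assms unfolding slit_plane_iff_nonpos_Reals
  by (auto intro!: derivative_eq_intros)

text \<open>The numerator vanishes at 0 together with its derivative, so the quotient has a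
  removable singularity there with value 0, which is also the value given by
  \<open>x / 0 = 0\<close>.\<close>

lemma averaged_exponent_holomorphic:
  fixes b c k :: real
  assumes b: "b > 0" and c: "c > 0"
  shows "(\<lambda>u. of_real k * ((of_real b + u) powr of_real (c + 1)
             - of_real (b powr c) * (of_real b + of_real (c + 1) * u))
            / (of_real (c + 1) * u)) holomorphic_on slit_plane b"
proof -
  define G where "G u = (of_real b + u) powr of_real (c + 1)
             - of_real (b powr c) * (of_real b + of_real (c + 1) * u)" for u :: complex
  have der: "(G has_field_derivative of_real (c + 1) * (of_real b + u) powr of_real c - of_real (b powr c) * of_real (c + 1)) (at u)"
    if "u \<in> slit_plane b" for u
    unfolding G_def
    by (rule derivative_eq_intros slit_plane_powr_has_field_derivative[OF that] refl | simp)+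
  have hol: "G holomorphic_on slit_plane b"
    using der holomorphic_on_open open_slit_plane by blast
  have pw: "complex_of_real b powr of_real x = of_real (b powr x)" for x
    using b by (simp add: powr_of_real)
  have "b powr (c + 1) = b powr c * b" using b by (simp add: powr_add)
  hence G0: "G 0 = 0"
    unfolding G_def by (simp add: pw del: of_real_add flip: of_real_mult)
  have "0 \<in> slit_plane b" using b by (simp add: mem_slit_plane_iff)
  from der[OF this] have dG0: "deriv G 0 = 0"
    by (simp add: pw DERIV_imp_deriv)
  \<comment> \<open>The difference quotient of \<open>G\<close> at 0, completed by the derivative,
    is holomorphic; as \<open>G 0\<close> and \<open>deriv G 0\<close> vanish, it agrees with the
    required quotient even at 0.\<close>
  have "(\<lambda>u. of_real (k / (c + 1)) * (if u = 0 then deriv G 0 else (G u - G 0) / (u - 0))) holomorphic_on slit_plane b"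
    by (intro holomorphic_intros pole_lemma_open hol open_slit_plane)
  also have "(\<lambda>u. of_real (k / (c + 1)) * (if u = 0 then deriv G 0 else (G u - G 0) / (u - 0)))
      = (\<lambda>u. of_real k * G u / (of_real (c + 1) * u))"
    by (auto simp: fun_eq_iff G0 dG0)
  finally show ?thesis unfolding G_def .
qed

text \<open>For imaginary \<open>u\<close> the whole line \<open>u * x\<close> avoids the slit, so
  the fundamental theorem of calculus applies along it.\<close>

lemma integral_averaged_exponent:
  fixes b c :: real and u :: complex
  assumes b: "b > 0" and c: "c > 0" and u: "Re u = 0"
  defines "g \<equiv> \<lambda>x. (of_real b + u * of_real x) powr of_real c - of_real (b powr c)"
  shows "continuous_on UNIV g"
    and "(LINT x:{0..1}|lborel. g x) = ((of_real b + u) powr of_real (c + 1)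
             - of_real (b powr c) * (of_real b + of_real (c + 1) * u)) / (of_real (c + 1) * u)"
proof -
  have mem: "u * of_real x \<in> slit_plane b" for x using u b by (simp add: mem_slit_plane_iff)
  show cont: "continuous_on UNIV g"
    unfolding g_def using u b c
    by (intro continuous_intros continuous_on_powr_complex) auto
  have pw: "complex_of_real b powr of_real x = of_real (b powr x)" for x
    using b by (simp add: powr_of_real)
  show "(LINT x:{0..1}|lborel. g x) = ((of_real b + u) powr of_real (c + 1)
             - of_real (b powr c) * (of_real b + of_real (c + 1) * u)) / (of_real (c + 1) * u)"
  proof (cases "u = 0")
    \<comment> \<open>At \<open>u = 0\<close> the integrand vanishes, and the right-hand side is 0
      by division by zero.\<close>
    case True thus ?thesis by (simp add: g_def pw)
  next
    case False
    \<comment> \<open>A complex antiderivative in \<open>z\<close>, restricted afterwards to real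
      arguments; its slope \<open>u\<close> is compensated by the denominator.\<close>
    define H where "H z = (of_real b + u * z) powr of_real (c + 1) / (of_real (c + 1) * u)
        - of_real (b powr c) * z" for z
    have c1: "complex_of_real (c + 1) \<noteq> 0" using c by (simp del: of_real_add)
    have "(H has_field_derivative g x) (at (complex_of_real x))" for x
    proof -
      have "((\<lambda>z. (of_real b + u * z) powr of_real (c + 1)) has_field_derivative
          of_real (c + 1) * (of_real b + u * of_real x) powr of_real c * u) (at (of_real x))"
        by (rule DERIV_chain2[where g="\<lambda>z. u * z", OF slit_plane_powr_has_field_derivative[OF mem] DERIV_cmult_Id])
      hence "(H has_field_derivative of_real (c + 1) * (of_real b + u * of_real x) powr of_real c * u / (of_real (c + 1) * u)
          - of_real (b powr c)) (at (of_real x))"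
        unfolding H_def
        by (intro DERIV_diff DERIV_cdivide DERIV_cmult_Id)
      thus ?thesis using False c1 by (simp add: g_def del: of_real_add)
    qed
    hence "((\<lambda>x. H (of_real x)) has_vector_derivative g x) (at x within {0..1})" for x
      using has_vector_derivative_real_field by blast
    hence "(LINT x:{0..1}|lborel. g x) = H (of_real 1) - H (of_real 0)"
      unfolding set_lebesgue_integral_def
      by (intro integral_FTC_Icc continuous_on_subset[OF cont]) auto
    also have "\<dots> = ((of_real b + u) powr of_real (c + 1)
             - of_real (b powr c) * (of_real b + of_real (c + 1) * u)) / (of_real (c + 1) * u)"
    proof -
      have "b powr (c + 1) = b powr c * b" using b by (simp add: powr_add)
      hence "complex_of_real b powr of_real (c + 1) = of_real (b powr c) * of_real b"
        by (simp add: pw del: of_real_add)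
      thus ?thesis using False c1 by (simp add: H_def field_simps del: of_real_add)
    qed
    finally show ?thesis .
  qed
qed

text \<open>The functional equation links \<open>Gamma (- c)\<close> to the positive number
  \<open>Gamma (1 - c)\<close> through the negative factor \<open>- c\<close>.\<close>

lemma Gamma_neg_unit_interval:
  assumes "0 < c" "c < 1"
  shows "Gamma (- c :: real) < 0"
proof -
  have "- c \<notin> \<int>\<^sub>\<le>\<^sub>0"
  proof
    assume "- c \<in> \<int>\<^sub>\<le>\<^sub>0"
    then obtain n where "- c = of_int n" by (auto elim!: nonpos_Ints_cases)
    hence "real_of_int (- 1) < real_of_int n" "real_of_int n < real_of_int 0" using assms by auto
    thus False unfolding of_int_less_iff by linarith
  qed
  hence "Gamma (- c + 1) = - c * Gamma (- c)" by (rule Gamma_plus1)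
  moreover have "Gamma (- c + 1) > 0" using assms by (intro Gamma_real_pos) auto
  ultimately have "c * Gamma (- c) < 0" by simp
  thus ?thesis using assms by (simp add: mult_less_0_iff)
qed

section \<open>Averages of a Levy process\<close>

text \<open>Raising \<open>N\<close> by one raises every weight by one, and the added increments
  telescope.\<close>

lemma sum_by_increments:
  fixes x :: "nat \<Rightarrow> real"
  shows "(\<Sum>k=1..N. x k) = real N * x 0 + (\<Sum>j<N. (real N - real j) * (x (Suc j) - x j))"
proof (induction N)
  case (Suc N)
  have "(\<Sum>j<Suc N. (real (Suc N) - real j) * (x (Suc j) - x j))
      = (\<Sum>j<Suc N. (real N - real j) * (x (Suc j) - x j)) + (\<Sum>j<Suc N. x (Suc j) - x j)"
    by (subst sum.distrib[symmetric]) (auto intro!: sum.cong simp: algebra_simps)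
  also have "(\<Sum>j<Suc N. x (Suc j) - x j) = x (Suc N) - x 0" by (rule sum_lessThan_telescope)
  finally show ?case using Suc by (simp add: algebra_simps)
qed simp

text \<open>Independence factorises the transform of the weighted increments, and stationarity
  evaluates each factor at time \<open>t / N\<close>. The exponent \<open>\<psi>\<close> stays
  abstract: \<open>marg\<close> asks that the marginal transforms be exponential in time.\<close>

lemma levy_average_laplace:
  fixes u :: complex and \<psi> :: "complex \<Rightarrow> complex"
  assumes levy: "levy_process M X" and t: "t > 0" and N: "N > 0" and b: "b > 0" and u: "Re u > - b"
    and marg: "\<And>s v. s \<ge> 0 \<Longrightarrow> Re v > - b \<Longrightarrow>
        integrable M (\<lambda>\<omega>. exp (- v * complex_of_real (X s \<omega>))) \<and>
        (LINT \<omega>|M. exp (- v * complex_of_real (X s \<omega>))) = exp (of_real s * \<psi> v)"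
  shows "integrable M (\<lambda>\<omega>. exp (- u * complex_of_real ((\<Sum>k=1..N. X (real k * t / real N) \<omega>) / real N)))" (is "integrable M ?e")
    and "(LINT \<omega>|M. exp (- u * complex_of_real ((\<Sum>k=1..N. X (real k * t / real N) \<omega>) / real N)))
          = exp (of_real (t / real N) * (\<Sum>k=1..N. \<psi> (u * of_real (real k / real N))))"
proof -
  interpret prob_space M using levy by (simp add: levy_process_def)
  have X[measurable]: "X s \<in> borel_measurable M" if "s \<ge> 0" for s
    using levy that by (simp add: levy_process_def)
  have X0: "AE \<omega> in M. X 0 \<omega> = 0" using levy by (simp add: levy_process_def)
  define s where "s i = real i * t / real N" for i :: nat
  have s: "0 \<le> s i" "s 0 = 0" "s i \<le> s (Suc i)" "s (Suc i) = s i + t / real N" for i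
    using t N by (auto simp: s_def field_simps)
  have Xs[measurable]: "X (s i) \<in> borel_measurable M" for i by (intro X s)
  have h: "0 \<le> t / real N" using t by simp
  have [measurable]: "X (t / real N) \<in> borel_measurable M" "X 0 \<in> borel_measurable M"
    by (intro X h, intro X order_refl)
  define D where "D j \<omega> = X (s (Suc j)) \<omega> - X (s j) \<omega>" for j \<omega>
  have D[measurable]: "D j \<in> borel_measurable M" for j unfolding D_def by measurable
  have indep: "indep_vars (\<lambda>_. borel) D {..<N}"
  proof -
    have "\<forall>n s. 0 \<le> s 0 \<and> (\<forall>i<n. s i \<le> s (Suc i)) \<longrightarrow>
        indep_vars (\<lambda>_. borel) (\<lambda>i \<omega>. X (s (Suc i)) \<omega> - X (s i) \<omega>) {..<n}"
      using levy unfolding levy_process_def by (elim conjE)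
    from this[rule_format, of s N] show ?thesis using s by (simp add: D_def[abs_def])
  qed
  have D_distr: "distr M borel (D j) = distr M borel (\<lambda>\<omega>. X (t / real N) \<omega> - X 0 \<omega>)" for j
  proof -
    have "\<forall>s\<ge>0. \<forall>h\<ge>0. distr M borel (\<lambda>\<omega>. X (s + h) \<omega> - X s \<omega>)
        = distr M borel (\<lambda>\<omega>. X h \<omega> - X 0 \<omega>)"
      using levy unfolding levy_process_def by (elim conjE)
    from this[rule_format, OF s(1)[of j] h] show ?thesis by (simp only: D_def[abs_def] s(4))
  qed
  define v where "v j = u * of_real ((real N - real j) / real N)" for j :: nat
  \<comment> \<open>The weights lie in \<open>(0, 1]\<close>, and contracting towards 0 keeps the
    real part above the negative number \<open>- b\<close>.\<close>
  have Rev: "Re (v j) > - b" if "j < N" for j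
  proof -
    have "0 < (real N - real j) / real N" "(real N - real j) / real N \<le> 1"
      using that by (auto simp: field_simps)
    hence "Re u * ((real N - real j) / real N) > - b"
      using u b by (smt (verit) mult_le_cancel_left1 mult_nonneg_nonneg)
    thus ?thesis by (simp add: v_def del: of_real_diff of_real_divide)
  qed
  \<comment> \<open>Stationarity compares each increment with \<open>X (t / N) - X 0\<close>, and
    \<open>X 0\<close> vanishes only almost surely; the marginal transform therefore enters up to a
    null set.\<close>
  have eqX: "AE \<omega> in M. exp (- w * complex_of_real (X (t / real N) \<omega> - X 0 \<omega>)) = exp (- w * complex_of_real (X (t / real N) \<omega>))" for w
    using X0 by eventually_elim simp
  have factor: "integrable M (\<lambda>\<omega>. exp (- v j * complex_of_real (D j \<omega>)))"
     "(LINT \<omega>|M. exp (- v j * complex_of_real (D j \<omega>))) = exp (of_real (t / real N) * \<psi> (v j))" if "j < N" for j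
  proof -
    note m = marg[OF h Rev[OF that]]
    have "integrable M (\<lambda>\<omega>. exp (- v j * complex_of_real (X (t / real N) \<omega> - X 0 \<omega>)))"
      by (subst integrable_cong_AE[OF _ _ eqX]) (use m in \<open>auto\<close>)
    hence "integrable (distr M borel (\<lambda>\<omega>. X (t / real N) \<omega> - X 0 \<omega>)) (\<lambda>y. exp (- v j * complex_of_real y))"
      by (subst integrable_distr_eq) auto
    thus "integrable M (\<lambda>\<omega>. exp (- v j * complex_of_real (D j \<omega>)))"
      unfolding D_distr[of j, symmetric] by (subst (asm) integrable_distr_eq) auto
    have "(LINT \<omega>|M. exp (- v j * complex_of_real (D j \<omega>))) = (LINT y|distr M borel (D j). exp (- v j * complex_of_real y))"
      by (subst integral_distr) auto
    also have "\<dots> = (LINT \<omega>|M. exp (- v j * complex_of_real (X (t / real N) \<omega> - X 0 \<omega>)))"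
      unfolding D_distr by (subst integral_distr) auto
    also have "\<dots> = (LINT \<omega>|M. exp (- v j * complex_of_real (X (t / real N) \<omega>)))"
      by (rule integral_cong_AE[OF _ _ eqX]) auto
    finally show "(LINT \<omega>|M. exp (- v j * complex_of_real (D j \<omega>))) = exp (of_real (t / real N) * \<psi> (v j))"
      using m by simp
  qed
  have indep': "indep_vars (\<lambda>_. borel) (\<lambda>j \<omega>. exp (- v j * complex_of_real (D j \<omega>))) {..<N}"
    by (rule indep_vars_compose2[OF indep]) measurable
  have prod: "AE \<omega> in M. ?e \<omega> = (\<Prod>j<N. exp (- v j * complex_of_real (D j \<omega>)))"
    using X0
  proof eventually_elim
    case (elim \<omega>)
    have "(\<Sum>k=1..N. X (real k * t / real N) \<omega>) = (\<Sum>j<N. (real N - real j) * D j \<omega>)"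
      using sum_by_increments[of "\<lambda>k. X (s k) \<omega>" N] elim unfolding D_def s(2) by (simp add: s_def)
    hence "- u * complex_of_real ((\<Sum>k=1..N. X (real k * t / real N) \<omega>) / real N)
        = (\<Sum>j<N. - v j * complex_of_real (D j \<omega>))"
      by (simp add: v_def sum_distrib_left sum_divide_distrib sum_negf mult_ac)
    thus ?case by (simp add: exp_sum)
  qed
  have me: "?e \<in> borel_measurable M" using Xs[unfolded s_def] by measurable
  show "integrable M ?e"
  proof (subst integrable_cong_AE[OF me _ prod])
    show "integrable M (\<lambda>\<omega>. \<Prod>j<N. exp (- v j * complex_of_real (D j \<omega>)))"
      by (rule indep_vars_integrable[OF _ indep' factor(1)]) auto
  qed measurable
  have "integral\<^sup>L M ?e = (LINT \<omega>|M. (\<Prod>j<N. exp (- v j * complex_of_real (D j \<omega>))))"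
    by (rule integral_cong_AE[OF me _ prod]) measurable
  also have "\<dots> = (\<Prod>j<N. LINT \<omega>|M. exp (- v j * complex_of_real (D j \<omega>)))"
    by (rule indep_vars_lebesgue_integral[OF _ indep' factor(1)]) auto
  also have "\<dots> = exp (of_real (t / real N) * (\<Sum>j<N. \<psi> (v j)))"
    using factor by (simp add: exp_sum sum_distrib_left)
  \<comment> \<open>Reversing the order by \<open>k = N - j\<close> turns the weights
    \<open>(N - j) / N\<close> into the right endpoints \<open>k / N\<close>.\<close>
  also have "(\<Sum>j<N. \<psi> (v j)) = (\<Sum>k=1..N. \<psi> (u * of_real (real k / real N)))"
    by (rule sum.reindex_bij_witness[of _ "\<lambda>k. N - k" "\<lambda>j. N - j"]) (auto simp: v_def of_nat_diff)
  finally show "integral\<^sup>L M ?e = exp (of_real (t / real N) * (\<Sum>k=1..N. \<psi> (u * of_real (real k / real N))))" .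
qed

text \<open>For negative exponents no dominating function is at hand; Fatou's lemma makes do with a
  uniform bound on the integrals.\<close>

lemma integrable_of_AE_limit_bounded_integrals:
  fixes f :: "'w \<Rightarrow> real"
  assumes g: "\<And>n. integrable M (g n)" "\<And>n x. g n x \<ge> 0" "\<And>n. integral\<^sup>L M (g n) \<le> B"
    and f: "f \<in> borel_measurable M" "AE x in M. (\<lambda>n. g n x) \<longlonglongrightarrow> f x"
  shows "integrable M f"
proof (rule integrableI_bounded[OF f(1)])
  have "(\<integral>\<^sup>+ x. ennreal (norm (f x)) \<partial>M) = (\<integral>\<^sup>+ x. liminf (\<lambda>n. ennreal (g n x)) \<partial>M)"
  proof (rule nn_integral_cong_AE, use f(2) in eventually_elim)
    case (elim x)
    hence "f x \<ge> 0" using g(2) by (intro LIMSEQ_le_const) auto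
    moreover have "liminf (\<lambda>n. ennreal (g n x)) = ennreal (f x)"
      using elim by (intro lim_imp_Liminf tendsto_ennrealI) auto
    ultimately show ?case by simp
  qed
  also have "\<dots> \<le> liminf (\<lambda>n. \<integral>\<^sup>+ x. ennreal (g n x) \<partial>M)"
    using g(1) by (intro nn_integral_liminf) auto
  also have "\<dots> \<le> liminf (\<lambda>n. ennreal B)"
    using g by (intro Liminf_mono always_eventually allI) (auto simp: nn_integral_eq_integral ennreal_leI)
  also have "\<dots> < \<infinity>" by (simp add: Liminf_const)
  finally show "(\<integral>\<^sup>+ x. ennreal (norm (f x)) \<partial>M) < \<infinity>" .
qed

text \<open>Almost every path is right continuous and bounded on \<open>{0..t}\<close>; the factor
  \<open>1 / t\<close> of the average cancels the length of the interval.\<close>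

lemma levy_running_average_limit:
  assumes "levy_process M X" "running_average M X A" "t > 0"
  shows "AE \<omega> in M. (\<lambda>n. (\<Sum>k=1..Suc n. X (real k * t / real (Suc n)) \<omega>) / real (Suc n)) \<longlonglongrightarrow> A t \<omega>"
proof -
  have "AE \<omega> in M. cadlag_on_nonneg (\<lambda>s. X s \<omega>)"
    using assms(1) unfolding levy_process_def by (elim conjE)
  moreover have "AE \<omega> in M. A t \<omega> = (1 / t) * (LINT s:{0..t}|lborel. X s \<omega>)"
    using assms(2,3) by (simp add: running_average_def)
  ultimately show ?thesis
  proof eventually_elim
    case (elim \<omega>)
    have "(\<lambda>n. (t / real (Suc n)) *\<^sub>R (\<Sum>k=1..Suc n. X (real k * t / real (Suc n)) \<omega>))
        \<longlonglongrightarrow> (LINT s:{0..t}|lborel. X s \<omega>)"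
      using elim(1) assms(3)
      by (intro right_riemann_sums_tendsto cadlag_on_nonneg_bounded) (auto simp: cadlag_on_nonneg_def)
    hence "(\<lambda>n. (1 / t) * ((t / real (Suc n)) *\<^sub>R (\<Sum>k=1..Suc n. X (real k * t / real (Suc n)) \<omega>)))
        \<longlonglongrightarrow> A t \<omega>"
      unfolding elim(2) by (rule tendsto_mult_left)
    thus ?case using assms(3) by simp
  qed
qed

section \<open>The tempered stable case\<close>

theorem theorem1:
  fixes M :: "'w measure" and X A :: "real \<Rightarrow> 'w \<Rightarrow> real" and a b c t :: real
  assumes "a > 0" and "b > 0" and "0 < c" and "c < 1"
    and "tempered_stable_subordinator M X a b c"
    and "running_average M X A"
    and "t \<ge> 0"
  shows "has_laplace_transform M (A t) b
    (\<lambda>u. exp (of_real (a * t * Gamma (-c)) *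
            ((of_real b + u) powr of_real (c + 1)
               - of_real (b powr c) * (of_real b + of_real (c + 1) * u))
            / (of_real (c + 1) * u)))"
proof -
  have levy: "levy_process M X"
    and marg: "\<And>s. s \<ge> 0 \<Longrightarrow> has_laplace_transform M (X s) b
        (\<lambda>u. exp (of_real (a * s * Gamma (-c)) *
               ((of_real b + u) powr of_real c - of_real (b powr c))))"
    using assms(5) by (auto simp: tempered_stable_subordinator_def)
  interpret prob_space M using levy by (simp add: levy_process_def)
  have At[measurable]: "A t \<in> borel_measurable M"
    using assms(6,7) by (simp add: running_average_def)
  have hol: "(\<lambda>u. exp (of_real (a * t * Gamma (-c)) *
            ((of_real b + u) powr of_real (c + 1)
               - of_real (b powr c) * (of_real b + of_real (c + 1) * u))
            / (of_real (c + 1) * u))) holomorphic_on slit_plane b"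
    by (intro holomorphic_on_exp' averaged_exponent_holomorphic assms)
  show ?thesis
  proof (cases "t = 0")
    case True
    \<comment> \<open>At \<open>t = 0\<close> the transform and the closed form are both 1, since
      the factor \<open>t\<close> annihilates the exponent.\<close>
    have A0: "AE \<omega> in M. A t \<omega> = 0" using assms(6) True by (simp add: running_average_def)
    show ?thesis
    proof (rule has_laplace_transformI[OF At assms(2) hol])
      fix r y :: real
      have "integrable M (\<lambda>\<omega>. exp (- r * A t \<omega>)) \<longleftrightarrow> integrable M (\<lambda>\<omega>. 1 :: real)"
        using A0 by (intro integrable_cong_AE) auto
      thus "integrable M (\<lambda>\<omega>. exp (- r * A t \<omega>))" by simp
      have "(LINT \<omega>|M. exp (- (\<i> * of_real y) * complex_of_real (A t \<omega>))) = (LINT \<omega>|M. 1)"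
        using A0 by (intro integral_cong_AE) auto
      also have "\<dots> = 1" by (simp add: prob_space)
      finally show "(LINT \<omega>|M. exp (- (\<i> * of_real y) * complex_of_real (A t \<omega>))) =
        exp (of_real (a * t * Gamma (-c)) *
            ((of_real b + \<i> * of_real y) powr of_real (c + 1)
               - of_real (b powr c) * (of_real b + of_real (c + 1) * (\<i> * of_real y)))
            / (of_real (c + 1) * (\<i> * of_real y)))"
        using True by simp
    qed
  next
    case False
    hence t: "t > 0" using assms by simp
    define K where "K = a * Gamma (- c)"
    have K: "K \<le> 0"
      unfolding K_def using Gamma_neg_unit_interval[OF assms(3,4)] assms(1) by (simp add: mult_nonneg_nonpos)
    \<comment> \<open>The Laplace exponent of \<open>X\<close> per unit of time, with its
      nonpositive constant \<open>K\<close> split off.\<close>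
    define \<psi> where "\<psi> v = of_real K * ((of_real b + v) powr of_real c - of_real (b powr c))" for v :: complex
    define Z where "Z n \<omega> = (\<Sum>k=1..Suc n. X (real k * t / real (Suc n)) \<omega>) / real (Suc n)" for n \<omega>
    have Xm: "X s \<in> borel_measurable M" if "s \<ge> 0" for s
      using levy that by (simp add: levy_process_def)
    have Z[measurable]: "Z n \<in> borel_measurable M" for n
      unfolding Z_def[abs_def] using t by (intro borel_measurable_divide borel_measurable_sum Xm) auto
    have lim: "AE \<omega> in M. (\<lambda>n. Z n \<omega>) \<longlonglongrightarrow> A t \<omega>"
      unfolding Z_def by (rule levy_running_average_limit[OF levy assms(6) t])
    have marg': "integrable M (\<lambda>\<omega>. exp (- v * complex_of_real (X s \<omega>))) \<and>
        (LINT \<omega>|M. exp (- v * complex_of_real (X s \<omega>))) = exp (of_real s * \<psi> v)"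
      if "s \<ge> 0" "Re v > - b" for s v
      using marg[OF that(1)] that(2)
      by (auto simp: has_laplace_transform_def mem_slit_plane_iff \<psi>_def K_def mult_ac)
    note Z_laplace = levy_average_laplace[OF levy t zero_less_Suc assms(2) _ marg', folded Z_def]
    show ?thesis
    proof (rule has_laplace_transformI[OF At assms(2) hol])
      fix r :: real assume r: "r \<ge> - b"
      \<comment> \<open>The transform of \<open>X s\<close> is not given at \<open>-b\<close>, so \<open>r\<close> is approached from the right.\<close>
      define \<rho> where "\<rho> n = r + inverse (real (Suc n))" for n
      have \<rho>: "\<rho> n > - b" for n
        unfolding \<rho>_def using r by (smt (verit) inverse_positive_iff_positive of_nat_0_less_iff zero_less_Suc)
      have \<rho>_lim: "\<rho> \<longlonglongrightarrow> r"
        using tendsto_add[OF tendsto_const LIMSEQ_inverse_real_of_nat, of r] unfolding \<rho>_def[abs_def] by simp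
      show "integrable M (\<lambda>\<omega>. exp (- r * A t \<omega>))"
      proof (rule integrable_of_AE_limit_bounded_integrals[where g="\<lambda>n \<omega>. exp (- \<rho> n * Z n \<omega>)"
            and B="exp (t * (- K * b powr c))"])
        fix n
        have Re\<rho>: "Re (complex_of_real (\<rho> n)) > - b" using \<rho> by simp
        show int: "integrable M (\<lambda>\<omega>. exp (- \<rho> n * Z n \<omega>))"
          using Z_laplace(1)[OF Re\<rho>, of n] unfolding integrable_exp_complex_iff[OF Z] by simp
        have \<psi>_le: "Re (\<psi> (of_real w)) \<le> - K * b powr c" if "w > - b" for w
        proof -
          have "\<psi> (of_real w) = of_real (K * ((b + w) powr c - b powr c))"
            unfolding \<psi>_def using that by (simp add: powr_of_real flip: of_real_add)
          hence "Re (\<psi> (of_real w)) = K * ((b + w) powr c - b powr c)" by simp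
          moreover have "K * (b + w) powr c \<le> 0" using K by (simp add: mult_nonpos_nonneg)
          ultimately show ?thesis by (simp add: algebra_simps)
        qed
        have scale: "\<rho> n * (real k / real (Suc n)) > - b" if "k \<in> {1..Suc n}" for k
        proof -
          have "0 < real k / real (Suc n)" "real k / real (Suc n) \<le> 1" using that by auto
          thus ?thesis using \<rho>[of n] assms(2) by (smt (verit) mult_le_cancel_left1 mult_nonneg_nonneg)
        qed
        have "complex_of_real (LINT \<omega>|M. exp (- \<rho> n * Z n \<omega>))
            = (LINT \<omega>|M. exp (- complex_of_real (\<rho> n) * complex_of_real (Z n \<omega>)))"
          by (subst integral_complex_of_real[symmetric]) (simp add: exp_of_real flip: of_real_mult of_real_minus)
        also have "\<dots> = exp (of_real (t / real (Suc n)) *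
            (\<Sum>k=1..Suc n. \<psi> (of_real (\<rho> n * (real k / real (Suc n))))))"
          using Z_laplace(2)[OF Re\<rho>, of n] by (simp only: of_real_mult)
        \<comment> \<open>The modulus of a complex exponential is the exponential of the real part,
          so it suffices to bound the real part of each summand.\<close>
        finally have "norm (complex_of_real (LINT \<omega>|M. exp (- \<rho> n * Z n \<omega>))) = exp ((t / real (Suc n)) *
            (\<Sum>k=1..Suc n. Re (\<psi> (of_real (\<rho> n * (real k / real (Suc n)))))))"
          by (simp only: norm_exp_eq_Re Re_sum times_complex.sel Re_complex_of_real Im_complex_of_real) simp
        also have "\<dots> \<le> exp ((t / real (Suc n)) * (\<Sum>k=1..Suc n. - K * b powr c))"
          using t scale by (subst exp_le_cancel_iff, intro mult_left_mono sum_mono \<psi>_le) auto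
        also have "(t / real (Suc n)) * (\<Sum>k=1..Suc n. - K * b powr c) = t * (- K * b powr c)"
          by (simp del: of_nat_Suc)
        finally show "(LINT \<omega>|M. exp (- \<rho> n * Z n \<omega>)) \<le> exp (t * (- K * b powr c))"
          by (simp only: norm_of_real)
      next
        show "AE \<omega> in M. (\<lambda>n. exp (- \<rho> n * Z n \<omega>)) \<longlonglongrightarrow> exp (- r * A t \<omega>)"
          using lim by eventually_elim (intro tendsto_intros \<rho>_lim)
      qed auto
    next
      fix y :: real
      define u where "u = \<i> * complex_of_real y"
      have u: "Re u = 0" "Re u > - b" using assms(2) by (auto simp: u_def)
      define g where "g x = (of_real b + u * of_real x) powr of_real c - of_real (b powr c)" for x :: real
      note cont = integral_averaged_exponent(1)[OF assms(2,3) u(1), folded g_def]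
      \<comment> \<open>Up to the factor \<open>t * K\<close>, the exponent of the transform of
        \<open>Z n\<close> is itself a right Riemann sum, now of \<open>g\<close> on
        \<open>{0..1}\<close>.\<close>
      have "(\<lambda>n. (1 / real (Suc n)) *\<^sub>R (\<Sum>k=1..Suc n. g (real k * 1 / real (Suc n))))
          \<longlonglongrightarrow> (LINT x:{0..1}|lborel. g x)"
      proof (rule right_riemann_sums_tendsto)
        show "(g \<longlongrightarrow> g s) (at_right s)" for s
          using cont by (simp add: continuous_on_eq_continuous_at isCont_def filterlim_at_split)
        show "bounded (g ` {0..1})"
          by (intro compact_imp_bounded compact_continuous_image continuous_on_subset[OF cont]) auto
      qed simp
      hence "(\<lambda>n. exp (of_real (t * K) * ((1 / real (Suc n)) *\<^sub>R (\<Sum>k=1..Suc n. g (real k * 1 / real (Suc n))))))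
          \<longlonglongrightarrow> exp (of_real (t * K) * (LINT x:{0..1}|lborel. g x))"
        by (intro tendsto_intros)
      also have "(\<lambda>n. exp (of_real (t * K) * ((1 / real (Suc n)) *\<^sub>R (\<Sum>k=1..Suc n. g (real k * 1 / real (Suc n))))))
          = (\<lambda>n. LINT \<omega>|M. exp (- u * complex_of_real (Z n \<omega>)))"
      proof
        fix n
        have "(\<Sum>k=1..Suc n. \<psi> (u * of_real (real k / real (Suc n))))
            = of_real K * (\<Sum>k=1..Suc n. g (real k * 1 / real (Suc n)))"
          by (simp only: \<psi>_def g_def sum_distrib_left mult_1_right)
        thus "exp (of_real (t * K) * ((1 / real (Suc n)) *\<^sub>R (\<Sum>k=1..Suc n. g (real k * 1 / real (Suc n)))))
            = (LINT \<omega>|M. exp (- u * complex_of_real (Z n \<omega>)))"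
          using Z_laplace(2)[OF u(2), of n]
          by (simp add: scaleR_conv_of_real mult_ac del: sum.cl_ivl_Suc of_nat_Suc)
      qed
      finally have "(\<lambda>n. LINT \<omega>|M. exp (- u * complex_of_real (Z n \<omega>)))
          \<longlonglongrightarrow> exp (of_real (t * K) * (LINT x:{0..1}|lborel. g x))" .
      moreover have "(\<lambda>n. LINT \<omega>|M. exp (- u * complex_of_real (Z n \<omega>)))
          \<longlonglongrightarrow> (LINT \<omega>|M. exp (- u * complex_of_real (A t \<omega>)))"
      \<comment> \<open>Since \<open>Re u = 0\<close>, all integrands have modulus 1, and constants
        are integrable on a probability space.\<close>
      proof (rule integral_dominated_convergence[where w="\<lambda>_. 1"])
        show "AE \<omega> in M. (\<lambda>n. exp (- u * complex_of_real (Z n \<omega>))) \<longlonglongrightarrow> exp (- u * complex_of_real (A t \<omega>))"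
          using lim by eventually_elim (intro tendsto_intros)
      qed (auto simp: u)
      ultimately have "(LINT \<omega>|M. exp (- u * complex_of_real (A t \<omega>)))
          = exp (of_real (t * K) * (LINT x:{0..1}|lborel. g x))"
        using LIMSEQ_unique by blast
      thus "(LINT \<omega>|M. exp (- (\<i> * of_real y) * complex_of_real (A t \<omega>))) =
        exp (of_real (a * t * Gamma (-c)) *
            ((of_real b + \<i> * of_real y) powr of_real (c + 1)
               - of_real (b powr c) * (of_real b + of_real (c + 1) * (\<i> * of_real y)))
            / (of_real (c + 1) * (\<i> * of_real y)))"
        unfolding integral_averaged_exponent(2)[OF assms(2,3) u(1), folded g_def] u_def
        by (simp add: K_def mult_ac)
    qed
  qed
qed

end
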